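(* Let $X$ and $Y$ be complex Banach spaces. Suppose that $\mathcal{O}\subset X$ is open, $\mathcal{K}\subset \mathcal{O}$ is compact, $u:\mathcal{O}\to Y$ is holomorphic, and there is a constant $C<\infty$ such that $\sup_{a\in \mathcal{O}}\|u(a)\|_Y\le C$. Given $s>0$, if $$\sup_{n\ge1}n^s d_n(\mathcal{K})_X<\infty,$$ then for any $0<t<s$ we have $$\sup_{n\ge1}n^t d_n(u(\mathcal{K}))_Y<\infty.$$
   Context: For a compact subset $\mathcal{A}$ of a Banach space $Z$ and an integer $n\ge 1$, the Kolmogorov $n$-width is $$d_n(\mathcal{A})_Z:=\inf_{\substack{V_n\subset Z\\ \dim V_n\le n}}\ \sup_{a\in\mathcal{A}}\ \inf_{v\in V_n}\|a-v\|_Z,$$ where $V_n$ ranges over linear subspaces of $Z$ of dimension at most $n$. For $m\ge1$, a continuous $m$-homogeneous polynomial $P:X\to Y$ is a continuous map of the form $P(x)=A(x,\ldots,x)$ for some $m$-linear map $A:X^m\to Y$. A mapping $u:\mathcal{O}\to Y$ on an open set $\mathcal{O}\subset X$ is holomorphic if for every $a\in\mathcal{O}$ there exist an open ball $B_X(a,r)\subset\mathcal{O}$ and continuous $m$-homogeneous polynomials $P_{a,m}:X\to Y$, $m\ge1$, such that $u(x)=u(a)+\sum_{m=1}^\infty P_{a,m}(x-a)$ uniformly for $x\in B_X(a,r)$ (equivalently, $u$ is complex Fréchet differentiable on $\mathcal{O}$). *)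

theory Defs
  imports "HOL-Analysis.Analysis"
begin

text \<open>The class \<open>banach\<close> of the library is that of real Banach spaces. A complex Banach space is a
  real one with a scalar multiplication by complex numbers which extends the real one and with
  respect to which the norm is homogeneous.\<close>

class complex_banach = banach +
  fixes scaleC :: "complex \<Rightarrow> 'a \<Rightarrow> 'a" (infixr \<open>*\<^sub>C\<close> 75)
  assumes scaleC_of_real: "complex_of_real r *\<^sub>C x = r *\<^sub>R x"
    and scaleC_add_right: "c *\<^sub>C (x + y) = c *\<^sub>C x + c *\<^sub>C y"
    and scaleC_add_left: "(c + d) *\<^sub>C x = c *\<^sub>C x + d *\<^sub>C x"
    and scaleC_scaleC: "c *\<^sub>C (d *\<^sub>C x) = (c * d) *\<^sub>C x"
    and norm_scaleC: "norm (c *\<^sub>C x) = cmod c * norm x"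

lemma scaleC_one: "1 *\<^sub>C x = (x :: 'a :: complex_banach)"
  using scaleC_of_real[of 1 x] by simp

global_interpretation complex_vector:
  vector_space "scaleC :: complex \<Rightarrow> 'a \<Rightarrow> 'a :: complex_banach"
  defines csubspace = complex_vector.subspace
    and cspan = complex_vector.span
    and cdependent = complex_vector.dependent
    and crepresentation = complex_vector.representation
    and cextend_basis = complex_vector.extend_basis
    and cdim = complex_vector.dim
  by unfold_locales
    (simp_all add: scaleC_add_right scaleC_add_left scaleC_scaleC scaleC_one)

instantiation complex :: complex_banach
begin

definition scaleC_complex :: "complex \<Rightarrow> complex \<Rightarrow> complex" where
  "scaleC_complex = (*)"

instance
  by standard (simp_all add: scaleC_complex_def scaleR_conv_of_real norm_mult algebra_simps)

end

text \<open>The value of \<open>cdim\<close> at an infinite-dimensional space is \<open>0\<close>, so finite dimensionality has to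
  be required separately. The width takes values in \<^typ>\<open>ennreal\<close>, so that all the suprema and infima
  are the genuine ones, also for the empty set.\<close>

definition kolmogorov_width :: "nat \<Rightarrow> 'a :: complex_banach set \<Rightarrow> ennreal" where
  "kolmogorov_width n \<A> =
     (INF V \<in> {V. csubspace V \<and> (\<exists>B. finite B \<and> V = cspan B) \<and> cdim V \<le> n}.
        SUP a\<in>\<A>. INF v\<in>V. ennreal (norm (a - v)))"

text \<open>An element of the $m$-fold power of the domain is represented by a list of length \<open>m\<close>; values of
  \<open>A\<close> at lists of other lengths are irrelevant.\<close>

definition cmultilinear :: "nat \<Rightarrow> ('a :: complex_banach list \<Rightarrow> 'b :: complex_banach) \<Rightarrow> bool" where
  "cmultilinear m A \<longleftrightarrow>
     (\<forall>xs i. length xs = m \<and> i < m \<longrightarrow>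
        Vector_Spaces.linear (*\<^sub>C) (*\<^sub>C) (\<lambda>x. A (xs[i := x])))"

definition continuous_homogeneous_polynomial ::
    "nat \<Rightarrow> ('a :: complex_banach \<Rightarrow> 'b :: complex_banach) \<Rightarrow> bool" where
  "continuous_homogeneous_polynomial m P \<longleftrightarrow>
     continuous_on UNIV P \<and> (\<exists>A. cmultilinear m A \<and> P = (\<lambda>x. A (replicate m x)))"

definition holomorphic_map_on ::
    "('a :: complex_banach \<Rightarrow> 'b :: complex_banach) \<Rightarrow> 'a set \<Rightarrow> bool" where
  "holomorphic_map_on u S \<longleftrightarrow>
     (\<forall>a\<in>S. \<exists>r>0. \<exists>P. ball a r \<subseteq> S \<and>
        (\<forall>m\<ge>1. continuous_homogeneous_polynomial m (P m)) \<and>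
        uniform_limit (ball a r) (\<lambda>N x. u a + (\<Sum>m = 1..N. P m (x - a))) u sequentially)"

end

theory Submission
  imports Defs
begin

text \<open>Fix \<open>R = 2 powr t'\<close> with \<open>t < t' < s\<close> and a centre \<open>a\<close>. Near \<open>a\<close>, nearly optimal spaces of
  dimension \<open>2 ^ j\<close> for the compact set give decompositions \<open>x - a = (\<Sum>j\<ge>q. \<delta> j)\<close> with \<open>\<delta> j\<close> in a
  fixed space of dimension at most \<open>2 * 2 ^ j\<close> and of norm at most a constant times \<open>2 powr (- s * j)\<close>.
  For large \<open>q\<close> the curve \<open>z \<mapsto> a + (\<Sum>j. z ^ j *\<^sub>C \<delta> j)\<close> maps the disc of radius \<open>R\<close> into a ball where the
  Taylor series of \<open>u\<close> at \<open>a\<close> converges uniformly, so by Cauchy's estimate the coefficient \<open>c l\<close> of \<open>z ^ l\<close>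
  of \<open>u\<close> along the curve is bounded by a constant times \<open>R powr (- l)\<close>. On the other hand, \<open>c l\<close> is a sum of
  terms \<open>A m [\<delta> (j 1), \<dots>, \<delta> (j m)]\<close> with \<open>j 1 + \<dots> + j m = l\<close> and all \<open>j i \<ge> q\<close>, so it
  lies in a space that does not depend on \<open>x\<close> and whose dimension is at most \<open>\<beta> ^ l\<close>, where
  \<open>\<beta> = 2 powr (t' / t) > 2\<close> and \<open>q\<close> is large. Truncating \<open>u x = (\<Sum>l. c l)\<close> at \<open>l = L\<close> gives dimension of order \<open>\<beta> ^ L\<close>
  with error of order \<open>R powr (- L) = (\<beta> ^ L) powr (- t)\<close>. Cauchy's estimate is applied to the partial sums of
  the Taylor series, which are polynomials in \<open>z\<close>, so that averaging over roots of unity suffices.\<close>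

section \<open>Cauchy's estimate for vector-valued polynomials\<close>

text \<open>The summands are the powers of the single number
  \<open>\<omega> ^ l / \<omega> ^ k\<close>, a \<open>D\<close>-th root of unity. Since
  \<open>k\<close> and \<open>l\<close> are both below \<open>D\<close>, it equals 1 only for
  \<open>k = l\<close>; otherwise the geometric sum over a full period vanishes.\<close>

lemma sum_root_unity_powers:
  fixes k l D :: nat
  assumes "k < D" "l < D"
  defines "\<omega> \<equiv> exp (2 * of_real pi * \<i> / of_nat D)"
  shows "(\<Sum>i<D. inverse (\<omega> ^ i) ^ k * (\<omega> ^ i) ^ l) = (if k = l then of_nat D else 0)"
proof -
  have \<omega>0: "\<omega> \<noteq> 0" by (simp add: \<omega>_def)
  have pow: "\<omega> ^ n = exp (2 * of_real pi * \<i> * of_nat n / of_nat D)" for n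
    by (simp add: \<omega>_def exp_of_nat_mult [symmetric] mult_ac)
  define x where "x = inverse \<omega> ^ k * \<omega> ^ l"
  have eq: "(\<Sum>i<D. inverse (\<omega> ^ i) ^ k * (\<omega> ^ i) ^ l) = (\<Sum>i<D. x ^ i)"
    by (rule sum.cong) (auto simp: x_def power_mult_distrib power_inverse mult.commute
        simp flip: power_mult)
  have \<omega>D: "\<omega> ^ D = 1"
    using assms(1) by (simp add: pow)
  show ?thesis
  proof (cases "k = l")
    case True
    then have "x = 1" using \<omega>0 by (simp add: x_def power_inverse)
    then show ?thesis using True eq by simp
  next
    case False
    have "\<omega> ^ k \<noteq> \<omega> ^ l"
      using complex_root_unity_eq[of D k l] False assms(1,2)
      by (auto simp: pow cong_def)
    then have "x \<noteq> 1" using \<omega>0 by (auto simp: x_def field_simps power_inverse)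
    moreover have "x ^ D = (inverse (\<omega> ^ D)) ^ k * (\<omega> ^ D) ^ l"
      by (simp add: x_def power_mult_distrib power_inverse mult.commute flip: power_mult)
    then have "x ^ D = 1" by (simp add: \<omega>D)
    ultimately show ?thesis using False eq by (simp add: sum_gp_strict)
  qed
qed

lemma norm_sum_scaleC_le:
  "norm (\<Sum>i\<in>I. c i *\<^sub>C x i) \<le> (\<Sum>i\<in>I. cmod (c i) * norm (x i))"
  by (rule order_trans[OF norm_sum]) (simp add: norm_scaleC)

text \<open>Sampling at \<open>D\<close> equally spaced points of the circle isolates
  \<open>c k\<close> exactly, without aliasing, because all degrees are below \<open>D\<close>. The
  resulting bound does not depend on \<open>D\<close>.\<close>

lemma Cauchy_estimate_polynomial:
  fixes c :: "nat \<Rightarrow> 'b :: complex_banach"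
  assumes bound: "\<And>z. cmod z = R \<Longrightarrow> norm (\<Sum>l<D. z ^ l *\<^sub>C c l) \<le> M"
    and "R > 0" "k < D"
  shows "norm (c k) \<le> M * (1 / R) ^ k"
proof -
  define \<omega> where "\<omega> = exp (2 * of_real pi * \<i> / of_nat D)"
  have n\<omega>: "cmod \<omega> = 1" by (simp add: \<omega>_def)
  define f where "f z = (\<Sum>l<D. z ^ l *\<^sub>C c l)" for z
  have "(\<Sum>i<D. inverse (\<omega> ^ i) ^ k *\<^sub>C f (of_real R * \<omega> ^ i))
      = (\<Sum>l<D. (\<Sum>i<D. inverse (\<omega> ^ i) ^ k * (\<omega> ^ i) ^ l * of_real R ^ l) *\<^sub>C c l)"
    unfolding f_def complex_vector.scale_sum_right complex_vector.scale_sum_left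
    by (subst sum.swap) (simp add: scaleC_scaleC power_mult_distrib mult_ac)
  also have "\<dots> = (\<Sum>l<D. (if k = l then of_nat D * of_real R ^ l else 0) *\<^sub>C c l)"
    by (rule sum.cong) (use sum_root_unity_powers[of k D] assms(3) in
        \<open>auto simp: \<omega>_def simp flip: sum_distrib_right\<close>)
  also have "\<dots> = (\<Sum>l<D. if k = l then (of_nat D * of_real R ^ l) *\<^sub>C c l else 0)"
    by (rule sum.cong) auto
  also have "\<dots> = (of_nat D * of_real R ^ k) *\<^sub>C c k"
    using assms(3) by simp
  finally have eq: "(of_nat D * of_real R ^ k) *\<^sub>C c k
      = (\<Sum>i<D. inverse (\<omega> ^ i) ^ k *\<^sub>C f (of_real R * \<omega> ^ i))" ..
  have "of_nat D * R ^ k * norm (c k) = norm ((of_nat D * of_real R ^ k) *\<^sub>C c k)"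
    using \<open>R > 0\<close> by (simp add: norm_scaleC norm_mult norm_power)
  also have "\<dots> \<le> (\<Sum>i<D. cmod (inverse (\<omega> ^ i) ^ k) * norm (f (of_real R * \<omega> ^ i)))"
    unfolding eq by (rule norm_sum_scaleC_le)
  also have "\<dots> \<le> (\<Sum>i<D. M)"
    by (rule sum_mono)
      (use bound \<open>R > 0\<close> n\<omega> in \<open>auto simp: f_def norm_power norm_inverse norm_mult\<close>)
  finally have "R ^ k * norm (c k) \<le> M"
    using assms(3) by (simp add: mult.assoc)
  then show ?thesis
    using \<open>R > 0\<close> by (simp add: field_simps power_divide)
qed

section \<open>Polynomials with coefficients in prescribed subspaces\<close>

text \<open>The number \<open>D\<close> of terms is left free: it varies between summands, and
  neither the Cauchy estimate nor the coefficient spaces depend on it.\<close>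

definition polynomial_with_coeffs :: "(nat \<Rightarrow> 'b :: complex_banach set) \<Rightarrow> (complex \<Rightarrow> 'b) \<Rightarrow> bool" where
  "polynomial_with_coeffs S f \<longleftrightarrow>
     (\<exists>D c. (\<forall>l. c l \<in> S l) \<and> (\<forall>z. f z = (\<Sum>l<D. z ^ l *\<^sub>C c l)))"

lemma polynomial_with_coeffs_mono:
  assumes "polynomial_with_coeffs S f" "\<And>l. S l \<subseteq> T l"
  shows "polynomial_with_coeffs T f"
  using assms unfolding polynomial_with_coeffs_def by (meson subsetD)

lemma polynomial_with_coeffs_const:
  assumes "y \<in> S 0" "\<And>l. csubspace (S l)"
  shows "polynomial_with_coeffs S (\<lambda>_. y)"
  unfolding polynomial_with_coeffs_def
  by (rule exI[of _ 1], rule exI[of _ "\<lambda>l. if l = 0 then y else 0"])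
    (use assms in \<open>auto simp: complex_vector.subspace_0 scaleC_one\<close>)

lemma polynomial_with_coeffs_add:
  assumes f: "polynomial_with_coeffs S f" and g: "polynomial_with_coeffs S g"
    and S: "\<And>l. csubspace (S l)"
  shows "polynomial_with_coeffs S (\<lambda>z. f z + g z)"
proof -
  obtain D c where c: "\<And>l. c l \<in> S l" "\<And>z. f z = (\<Sum>l<D. z ^ l *\<^sub>C c l)"
    using f by (auto simp: polynomial_with_coeffs_def)
  obtain E d where d: "\<And>l. d l \<in> S l" "\<And>z. g z = (\<Sum>l<E. z ^ l *\<^sub>C d l)"
    using g by (auto simp: polynomial_with_coeffs_def)
  have pad: "\<And>z c' D' E'. (\<Sum>l<D'. z ^ l *\<^sub>C c' l) = (\<Sum>l<D' + E'. z ^ l *\<^sub>C (if l < D' then c' l else (0 :: 'b :: complex_banach)))"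
    by (rule sum.mono_neutral_cong_left) auto
  let ?e = "\<lambda>l. (if l < D then c l else 0) + (if l < E then d l else 0)"
  have "?e l \<in> S l" for l
    using c d S by (intro complex_vector.subspace_add) (auto simp: complex_vector.subspace_0)
  moreover have "f z + g z = (\<Sum>l<D + E. z ^ l *\<^sub>C ?e l)" for z
    unfolding c d using pad[of z c D E] pad[of z d E D]
    by (simp only: scaleC_add_right sum.distrib add.commute)
  ultimately show ?thesis
    unfolding polynomial_with_coeffs_def by (intro exI[of _ "D + E"] exI[of _ ?e]) blast
qed

lemma polynomial_with_coeffs_sum:
  assumes "\<And>i. i \<in> I \<Longrightarrow> polynomial_with_coeffs S (f i)" and S: "\<And>l. csubspace (S l)"
  shows "polynomial_with_coeffs S (\<lambda>z. \<Sum>i\<in>I. f i z)"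
  using assms(1)
  by (induction I rule: infinite_finite_induct)
    (auto intro!: polynomial_with_coeffs_add polynomial_with_coeffs_const S
      complex_vector.subspace_0)

lemma polynomial_with_coeffs_shift:
  assumes f: "polynomial_with_coeffs S f"
    and S: "\<And>l. S l \<subseteq> T (j + l)" and T: "\<And>l. csubspace (T l)"
  shows "polynomial_with_coeffs T (\<lambda>z. z ^ j *\<^sub>C f z)"
proof -
  obtain D c where c: "\<And>l. c l \<in> S l" "\<And>z. f z = (\<Sum>l<D. z ^ l *\<^sub>C c l)"
    using f by (auto simp: polynomial_with_coeffs_def)
  let ?e = "\<lambda>l. if l < j then 0 else c (l - j)"
  have "?e l \<in> T l" for l
    using c(1)[of "l - j"] S[of "l - j"] T[of l] by (auto simp: complex_vector.subspace_0)
  moreover have "z ^ j *\<^sub>C f z = (\<Sum>l<j + D. z ^ l *\<^sub>C ?e l)" for z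
  proof -
    have "(\<Sum>l<j + D. z ^ l *\<^sub>C ?e l) = (\<Sum>l\<in>{j..<j + D}. z ^ l *\<^sub>C ?e l)"
      by (rule sum.mono_neutral_right) auto
    also have "\<dots> = (\<Sum>l<D. z ^ (l + j) *\<^sub>C ?e (l + j))"
      using sum.shift_bounds_nat_ivl[of "\<lambda>l. z ^ l *\<^sub>C ?e l" 0 j D]
      by (simp add: atLeast0LessThan add.commute)
    finally show ?thesis
      by (simp add: c complex_vector.scale_sum_right scaleC_scaleC power_add mult.commute)
  qed
  ultimately show ?thesis
    unfolding polynomial_with_coeffs_def by (intro exI[of _ "j + D"] exI[of _ ?e]) blast
qed

section \<open>Multilinear expansion along a curve and counting of words\<close>

text \<open>Words index the vectors that span the space of the coefficient of \<open>z ^ l\<close>.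
  A letter has the weight of the set it is drawn from; as the sets \<open>B j\<close> may overlap,
  one list can have several weights.\<close>

inductive weighted_word :: "(nat \<Rightarrow> 'a set) \<Rightarrow> nat \<Rightarrow> 'a list \<Rightarrow> bool" for B where
  Nil: "weighted_word B 0 []"
| Cons: "b \<in> B j \<Longrightarrow> weighted_word B l bs \<Longrightarrow> weighted_word B (j + l) (b # bs)"

lemma cmultilinear_Cons:
  assumes "cmultilinear (Suc m) A"
  shows "cmultilinear m (\<lambda>bs. A (d # bs))"
  unfolding cmultilinear_def
proof (intro allI impI, elim conjE)
  fix xs :: "'a list" and i assume "length xs = m" "i < m"
  then show "Vector_Spaces.linear (*\<^sub>C) (*\<^sub>C) (\<lambda>x. A (d # xs[i := x]))"
    using assms[unfolded cmultilinear_def, rule_format, of "d # xs" "Suc i"] by simp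
qed

lemma cmultilinear_hd:
  assumes "cmultilinear (Suc m) A" "length bs = m"
  shows "Vector_Spaces.linear (*\<^sub>C) (*\<^sub>C) (\<lambda>x. A (x # bs))"
  using assms(1)[unfolded cmultilinear_def, rule_format, of "undefined # bs" 0] assms(2) by simp

lemma linear_image_cspan:
  assumes "Vector_Spaces.linear (*\<^sub>C) (*\<^sub>C) f" "x \<in> cspan S"
  shows "f x \<in> cspan (f ` S)"
proof -
  interpret f: Vector_Spaces.linear "(*\<^sub>C)" "(*\<^sub>C)" f by fact
  show ?thesis using f.span_image[of S] assms(2) unfolding cspan_def by blast
qed

text \<open>Only the coefficients of \<open>z ^ l\<close> with \<open>l \<le> L\<close> are controlled below: the last increment of a
  decomposition of \<open>x - a\<close> is a remainder of weight \<open>L + 1\<close> that lies in no particular space.\<close>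

lemma cmultilinear_along_curve:
  fixes \<delta> :: "nat \<Rightarrow> 'a :: complex_banach" and A :: "'a list \<Rightarrow> 'b :: complex_banach"
  assumes "cmultilinear m A" and "\<And>j. j \<le> L \<Longrightarrow> \<delta> j \<in> cspan (B j)"
  shows "polynomial_with_coeffs
    (\<lambda>l. if l \<le> L then cspan (A ` {bs. weighted_word B l bs \<and> length bs = m}) else UNIV)
    (\<lambda>z. A (replicate m (\<Sum>j\<le>J. z ^ j *\<^sub>C \<delta> j)))"
  using assms(1)
proof (induction m arbitrary: A)
  case 0
  show ?case
    using weighted_word.Nil[of B]
    by (auto intro!: polynomial_with_coeffs_const complex_vector.span_base)
next
  case (Suc m)
  let ?\<gamma> = "\<lambda>z. \<Sum>j\<le>J. z ^ j *\<^sub>C \<delta> j"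
  let ?S = "\<lambda>l. if l \<le> L then cspan (A ` {bs. weighted_word B l bs \<and> length bs = Suc m}) else UNIV"
  have S: "csubspace (?S l)" for l by simp
  have eq: "A (replicate (Suc m) (?\<gamma> z)) = (\<Sum>j\<le>J. z ^ j *\<^sub>C A (\<delta> j # replicate m (?\<gamma> z)))" for z
  proof -
    interpret f: Vector_Spaces.linear "(*\<^sub>C)" "(*\<^sub>C)" "\<lambda>x. A (x # replicate m (?\<gamma> z))"
      by (rule cmultilinear_hd[OF Suc.prems]) simp
    show ?thesis by (simp add: f.sum f.scale)
  qed
  show ?case unfolding eq
  proof (intro polynomial_with_coeffs_sum S)
    fix j
    show "polynomial_with_coeffs ?S (\<lambda>z. z ^ j *\<^sub>C A (\<delta> j # replicate m (?\<gamma> z)))"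
    proof (rule polynomial_with_coeffs_shift[OF Suc.IH[OF cmultilinear_Cons[OF Suc.prems]] _ S])
      fix l
      show "(if l \<le> L then cspan ((\<lambda>bs. A (\<delta> j # bs)) ` {bs. weighted_word B l bs \<and> length bs = m})
            else UNIV) \<subseteq> ?S (j + l)"
      proof (cases "j + l \<le> L")
        case True
        have "A (\<delta> j # bs) \<in> ?S (j + l)" if "weighted_word B l bs" "length bs = m" for bs
        proof -
          have "A (\<delta> j # bs) \<in> cspan ((\<lambda>x. A (x # bs)) ` B j)"
            by (rule linear_image_cspan[OF cmultilinear_hd[OF Suc.prems that(2)] assms(2)])
              (use True in simp)
          also have "\<dots> \<subseteq> cspan (A ` {bs. weighted_word B (j + l) bs \<and> length bs = Suc m})"
            using that by (intro complex_vector.span_mono) (auto intro: weighted_word.Cons)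
          finally show ?thesis using True by simp
        qed
        then have "cspan ((\<lambda>bs. A (\<delta> j # bs)) ` {bs. weighted_word B l bs \<and> length bs = m}) \<subseteq> ?S (j + l)"
          by (intro complex_vector.span_minimal S) blast
        then show ?thesis using True by simp
      qed auto
    qed
  qed
qed

text \<open>This is a generating function argument. Splitting off the first letter bounds the number
  of words of weight \<open>l\<close> by a convolution of the numbers \<open>card (B j)\<close> with
  the counts of smaller weight, and the bound \<open>\<beta> ^ l\<close> reproduces itself when the
  generating function of the letters is at most 1 at \<open>1 / \<beta>\<close>.\<close>

lemma weighted_word_card:
  fixes \<beta> :: real
  assumes fin: "\<And>j. finite (B j)" and B0: "B 0 = {}" and "\<beta> > 0"
    and sum: "\<And>n. (\<Sum>j = 1..n. real (card (B j)) * (1 / \<beta>) ^ j) \<le> 1"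
  shows "finite {bs. weighted_word B l bs} \<and> real (card {bs. weighted_word B l bs}) \<le> \<beta> ^ l"
proof (induction l rule: less_induct)
  case (less l)
  let ?W = "\<lambda>l. {bs. weighted_word B l bs}"
  show ?case
  proof (cases "l = 0")
    case True
    have "bs = []" if "weighted_word B l' bs" "l' = 0" for l' bs
      using that by (induction) (use B0 in auto)
    then have "?W 0 = {[]}" by (auto intro: weighted_word.Nil)
    then show ?thesis using True by simp
  next
    case False
    \<comment> \<open>As \<open>B 0\<close> is empty, the first letter has weight
      \<open>j \<ge> 1\<close>, so the rest of the word has weight \<open>l - j < l\<close> and the
      induction hypothesis applies.\<close>
    let ?U = "\<Union>j\<in>{1..l}. (\<lambda>(b, bs). b # bs) ` (B j \<times> ?W (l - j))"
    have "bs \<in> ?U" if "weighted_word B l bs" for bs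
      using that
    proof cases
      case Nil then show ?thesis using False by simp
    next
      case (Cons b j l' bs')
      then have "j \<noteq> 0" using B0 by (metis empty_iff)
      then show ?thesis using Cons
        by (intro UN_I[of j] image_eqI[of _ _ "(b, bs')"]) auto
    qed
    then have sub: "?W l \<subseteq> ?U" by blast
    have IH: "finite (?W (l - j))" "real (card (?W (l - j))) \<le> \<beta> ^ (l - j)" if "j \<in> {1..l}" for j
      using less[of "l - j"] that by auto
    have finU: "finite ?U" using IH fin by (intro finite_UN_I finite_imageI finite_cartesian_product) auto
    have "card (?W l) \<le> card ?U" by (rule card_mono[OF finU sub])
    also have "\<dots> \<le> (\<Sum>j = 1..l. card ((\<lambda>(b, bs). b # bs) ` (B j \<times> ?W (l - j))))"
      by (rule card_UN_le) simp
    also have "\<dots> \<le> (\<Sum>j = 1..l. card (B j) * card (?W (l - j)))"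
      unfolding card_cartesian_product [symmetric]
      by (intro sum_mono card_image_le finite_cartesian_product) (use IH fin in auto)
    finally have "real (card (?W l)) \<le> (\<Sum>j = 1..l. real (card (B j)) * real (card (?W (l - j))))"
      by (simp flip: of_nat_mult of_nat_sum)
    also have "\<dots> \<le> (\<Sum>j = 1..l. real (card (B j)) * \<beta> ^ (l - j))"
      by (intro sum_mono mult_left_mono IH) auto
    also have "\<dots> = \<beta> ^ l * (\<Sum>j = 1..l. real (card (B j)) * (1 / \<beta>) ^ j)"
      unfolding sum_distrib_left using \<open>\<beta> > 0\<close>
      by (intro sum.cong) (auto simp: power_diff power_divide)
    also have "\<dots> \<le> \<beta> ^ l" using sum[of l] \<open>\<beta> > 0\<close> by (simp add: mult_le_cancel_left1)
    finally show ?thesis using finite_subset[OF sub finU] by simp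
  qed
qed

section \<open>Truncation of the Taylor series along a curve\<close>

lemma geometric_segment_le:
  fixes x :: real
  assumes "0 \<le> x" "x < 1"
  shows "(\<Sum>l = m..<n. x ^ l) \<le> x ^ m / (1 - x)"
proof -
  have "(\<Sum>l = m..<n. x ^ l) * (1 - x) \<le> x ^ m - x ^ n" if "m \<le> n"
    using that by (induction n rule: dec_induct) (auto simp: algebra_simps)
  then have "(\<Sum>l = m..<n. x ^ l) * (1 - x) \<le> x ^ m"
    using zero_le_power[OF assms(1), of n] zero_le_power[OF assms(1), of m] by (cases "m \<le> n") auto
  then show ?thesis using assms by (simp add: pos_le_divide_eq)
qed

text \<open>The constant has two sources: \<open>(C + 1) / (R - 1)\<close> bounds the tail of
  coefficients beyond \<open>L\<close>, and 1 comes from replacing \<open>u\<close> by a Taylor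
  polynomial with tolerance \<open>(1 / R) ^ L\<close>. The spanning set depends only on
  \<open>A\<close>, \<open>B\<close> and \<open>L\<close>, so it serves all points \<open>x\<close>
  at once.\<close>

lemma taylor_truncation:
  fixes u :: "'a :: complex_banach \<Rightarrow> 'b :: complex_banach"
  assumes "R > 1" and A: "\<And>m. cmultilinear m (A m)"
    and lim: "uniform_limit (ball a r) (\<lambda>N x. \<Sum>m\<le>N. A m (replicate m (x - a))) u sequentially"
    and C: "\<And>y. y \<in> ball a r \<Longrightarrow> norm (u y) \<le> C"
    and \<delta>: "\<And>j. j \<le> L \<Longrightarrow> \<delta> j \<in> cspan (B j)"
    and x: "x - a = (\<Sum>j\<le>J. \<delta> j)" and r: "(\<Sum>j\<le>J. R ^ j * norm (\<delta> j)) < r"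
  shows "\<exists>v \<in> cspan ((\<lambda>bs. A (length bs) bs) ` {bs. \<exists>l\<le>L. weighted_word B l bs}).
           norm (u x - v) \<le> ((C + 1) / (R - 1) + 1) * (1 / R) ^ L"
proof -
  let ?g = "\<lambda>z. \<Sum>j\<le>J. z ^ j *\<^sub>C \<delta> j"
  let ?V = "\<lambda>l. cspan ((\<lambda>bs. A (length bs) bs) ` {bs. weighted_word B l bs})"
  have "(1 / R) ^ L > 0" using \<open>R > 1\<close> by simp
  from uniform_limitD[OF lim this] obtain N where
    N: "\<And>y. y \<in> ball a r \<Longrightarrow> dist (\<Sum>m\<le>N. A m (replicate m (y - a))) (u y) < (1 / R) ^ L"
    unfolding eventually_sequentially by blast
  define p where "p z = (\<Sum>m\<le>N. A m (replicate m (?g z)))" for z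
  have "polynomial_with_coeffs (\<lambda>l. if l \<le> L then ?V l else UNIV) p"
    unfolding p_def
  proof (intro polynomial_with_coeffs_sum)
    fix m
    show "polynomial_with_coeffs (\<lambda>l. if l \<le> L then ?V l else UNIV) (\<lambda>z. A m (replicate m (?g z)))"
      \<comment> \<open>On words of length \<open>m\<close>, \<open>A m bs\<close> is
        \<open>A (length bs) bs\<close>. Dropping the length restriction thus gives a space common
        to all \<open>m\<close>, independent of the Taylor degree \<open>N\<close>, which varies
        with \<open>L\<close>.\<close>
      by (rule polynomial_with_coeffs_mono[OF cmultilinear_along_curve[OF A[of m] \<delta>]])
        (auto elim!: complex_vector.span_mono[THEN subsetD, rotated])
  qed auto
  then obtain D c where c': "\<And>l. c l \<in> (if l \<le> L then ?V l else UNIV)"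
    and p: "\<And>z. p z = (\<Sum>l<D. z ^ l *\<^sub>C c l)"
    unfolding polynomial_with_coeffs_def by blast
  have c: "c l \<in> ?V l" if "l \<le> L" for l
    using c'[of l] that by simp
  have ball: "a + ?g z \<in> ball a r" if "cmod z \<le> R" for z
  proof -
    have "norm (?g z) \<le> (\<Sum>j\<le>J. cmod (z ^ j) * norm (\<delta> j))"
      by (rule norm_sum_scaleC_le)
    also have "\<dots> \<le> (\<Sum>j\<le>J. R ^ j * norm (\<delta> j))"
      by (intro sum_mono mult_right_mono) (auto simp: norm_power intro: power_mono that)
    finally show ?thesis using r by (simp add: dist_norm)
  qed
  have close: "norm (p z - u (a + ?g z)) < (1 / R) ^ L" if "cmod z \<le> R" for z
    using N[OF ball[OF that]] by (simp add: p_def dist_norm)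
  have "norm (p z) \<le> C + 1" if "cmod z = R" for z
  proof -
    have "(1 / R) ^ L \<le> 1" using \<open>R > 1\<close> by (simp add: power_le_one)
    then show ?thesis
      using close[of z] C[OF ball[of z]] that norm_triangle_ineq2[of "p z" "u (a + ?g z)"] by simp
  qed
  then have cb: "norm (c l) \<le> (C + 1) * (1 / R) ^ l" if "l < D" for l
    using Cauchy_estimate_polynomial[where R = R and D = D and c = c and M = "C + 1" and k = l] \<open>R > 1\<close> that p by simp
  \<comment> \<open>The centre of the ball shows that \<open>C\<close> is nonnegative.\<close>
  have "0 \<le> norm (u (a + ?g 0))" by (rule norm_ge_zero)
  also have "\<dots> \<le> C" by (rule C[OF ball]) (use \<open>R > 1\<close> in simp)
  finally have C0: "C + 1 \<ge> 0" by linarith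
  \<comment> \<open>The condition \<open>l < D\<close> restricts to the coefficients that occur in
    \<open>p\<close>. The remaining tail starts at \<open>Suc L\<close>, and this extra factor
    \<open>1 / R\<close> turns the geometric bound into
    \<open>(1 / R) ^ L / (R - 1)\<close>.\<close>
  define v where "v = sum c {l. l < D \<and> l \<le> L}"
  have "v \<in> cspan ((\<lambda>bs. A (length bs) bs) ` {bs. \<exists>l\<le>L. weighted_word B l bs})"
    unfolding v_def
  proof (rule complex_vector.span_sum)
    fix l assume "l \<in> {l. l < D \<and> l \<le> L}"
    then show "c l \<in> cspan ((\<lambda>bs. A (length bs) bs) ` {bs. \<exists>l\<le>L. weighted_word B l bs})"
      using c[of l] complex_vector.span_mono[of "(\<lambda>bs. A (length bs) bs) ` {bs. weighted_word B l bs}"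
          "(\<lambda>bs. A (length bs) bs) ` {bs. \<exists>l\<le>L. weighted_word B l bs}"] by blast
  qed
  moreover have "norm (u x - v) \<le> ((C + 1) / (R - 1) + 1) * (1 / R) ^ L"
  proof -
    have "p 1 - v = sum c {Suc L..<D}"
      unfolding p v_def by (simp add: scaleC_one, subst sum_diff[symmetric])
        (auto intro!: arg_cong[of _ _ "sum c"])
    then have "norm (p 1 - v) \<le> (\<Sum>l = Suc L..<D. (C + 1) * (1 / R) ^ l)"
      by (auto intro!: order_trans[OF norm_sum] sum_mono cb)
    also have "\<dots> = (C + 1) * (\<Sum>l = Suc L..<D. (1 / R) ^ l)" by (simp add: sum_distrib_left)
    also have "\<dots> \<le> (C + 1) * ((1 / R) ^ L / (R - 1))"
    proof (rule mult_left_mono[OF _ C0])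
      have "(\<Sum>l = Suc L..<D. (1 / R) ^ l) \<le> (1 / R) ^ Suc L / (1 - 1 / R)"
        using \<open>R > 1\<close> by (intro geometric_segment_le) auto
      also have "\<dots> = (1 / R) ^ L * ((1 / R) / (1 - 1 / R))" by simp
      also have "(1 / R) / (1 - 1 / R) = 1 / (R - 1)" using \<open>R > 1\<close> by (simp add: divide_simps)
      finally show "(\<Sum>l = Suc L..<D. (1 / R) ^ l) \<le> (1 / R) ^ L / (R - 1)" by simp
    qed
    finally have 1: "norm (p 1 - v) \<le> (C + 1) / (R - 1) * (1 / R) ^ L" by simp
    have "a + ?g 1 = x" by (simp add: scaleC_one flip: x)
    then have 2: "norm (p 1 - u x) \<le> (1 / R) ^ L" using close[of 1] \<open>R > 1\<close> by simp
    have "norm (u x - v) \<le> norm (p 1 - v) + norm (p 1 - u x)"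
      using norm_triangle_ineq4[of "p 1 - v" "p 1 - u x"] by simp
    with 1 2 show ?thesis unfolding distrib_right by linarith
  qed
  ultimately show ?thesis by blast
qed

section \<open>Widths in terms of finite spanning sets\<close>

text \<open>The strict bound yields an actual space and, for each point, an actual approximant
  although the infima need not be attained. A basis of the space supplies at most \<open>n\<close>
  generators.\<close>

lemma kolmogorov_width_lessE:
  assumes "kolmogorov_width n K < ennreal e"
  obtains E where "finite E" "card E \<le> n" "\<And>x. x \<in> K \<Longrightarrow> \<exists>v\<in>cspan E. norm (x - v) < e"
proof -
  from assms obtain V B where V: "csubspace V" "finite B" "V = cspan B" "cdim V \<le> n"
    and lt: "(SUP a\<in>K. INF v\<in>V. ennreal (norm (a - v))) < ennreal e"
    unfolding kolmogorov_width_def INF_less_iff by blast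
  obtain E where E: "E \<subseteq> V" "\<not> cdependent E" "V \<subseteq> cspan E" "card E = cdim V"
    by (rule complex_vector.basis_exists)
  have VE: "V = cspan E"
    using E V complex_vector.span_minimal by blast
  have "finite E"
    using complex_vector.independent_span_bound[of B E] E V by blast
  moreover have "\<exists>v\<in>cspan E. norm (x - v) < e" if "x \<in> K" for x
  proof -
    have "(INF v\<in>V. ennreal (norm (x - v))) < ennreal e"
      using that by (intro le_less_trans[OF SUP_upper lt])
    then show ?thesis
      unfolding INF_less_iff VE by (auto simp: ennreal_less_iff)
  qed
  ultimately show thesis using that E V by metis
qed

lemma kolmogorov_width_le:
  assumes "finite F" "card F \<le> n" "\<And>x. x \<in> K \<Longrightarrow> \<exists>v\<in>cspan F. norm (x - v) \<le> e"
  shows "kolmogorov_width n K \<le> ennreal e"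
  unfolding kolmogorov_width_def
proof (rule INF_lower2)
  show "cspan F \<in> {V. csubspace V \<and> (\<exists>B. finite B \<and> V = cspan B) \<and> cdim V \<le> n}"
    using assms(1,2) complex_vector.dim_le_card'[OF assms(1)] by auto
  show "(SUP a\<in>K. INF v\<in>cspan F. ennreal (norm (a - v))) \<le> ennreal e"
  proof (rule SUP_least)
    fix x assume "x \<in> K"
    then obtain v where "v \<in> cspan F" "norm (x - v) \<le> e" using assms(3) by blast
    then show "(INF v\<in>cspan F. ennreal (norm (x - v))) \<le> ennreal e"
      by (intro INF_lower2[of v] ennreal_leI)
  qed
qed

section \<open>Geometric rates of approximation\<close>

text \<open>For \<open>R = \<beta> powr t\<close> this is width decay of order \<open>t\<close>,
  sampled at dimensions of order \<open>\<beta> ^ L\<close>. Free constants \<open>\<kappa>\<close>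
  and \<open>c\<close> make the property stable under finite unions, as the compactness argument
  requires.\<close>

definition geometric_approximation :: "real \<Rightarrow> real \<Rightarrow> 'b :: complex_banach set \<Rightarrow> bool" where
  "geometric_approximation R \<beta> Y \<longleftrightarrow>
     (\<exists>\<kappa> c. \<forall>L. \<exists>F. finite F \<and> real (card F) \<le> \<kappa> * \<beta> ^ L \<and>
        (\<forall>y\<in>Y. \<exists>v\<in>cspan F. norm (y - v) \<le> c * (1 / R) ^ L))"

lemma geometric_approximation_Un:
  assumes Y: "geometric_approximation R \<beta> Y" and Z: "geometric_approximation R \<beta> Z" and "R > 0"
  shows "geometric_approximation R \<beta> (Y \<union> Z)"
proof -
  obtain \<kappa> c where 1: "\<And>L. \<exists>F. finite F \<and> real (card F) \<le> \<kappa> * \<beta> ^ L \<and>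
        (\<forall>y\<in>Y. \<exists>v\<in>cspan F. norm (y - v) \<le> c * (1 / R) ^ L)"
    using Y unfolding geometric_approximation_def by blast
  obtain \<kappa>' c' where 2: "\<And>L. \<exists>F. finite F \<and> real (card F) \<le> \<kappa>' * \<beta> ^ L \<and>
        (\<forall>y\<in>Z. \<exists>v\<in>cspan F. norm (y - v) \<le> c' * (1 / R) ^ L)"
    using Z unfolding geometric_approximation_def by blast
  show ?thesis unfolding geometric_approximation_def
  proof (rule exI[of _ "\<kappa> + \<kappa>'"], rule exI[of _ "max c c'"], rule allI)
    fix L
    obtain F where F: "finite F" "real (card F) \<le> \<kappa> * \<beta> ^ L"
        "\<forall>y\<in>Y. \<exists>v\<in>cspan F. norm (y - v) \<le> c * (1 / R) ^ L"
      using 1[of L] by blast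
    obtain F' where F': "finite F'" "real (card F') \<le> \<kappa>' * \<beta> ^ L"
        "\<forall>y\<in>Z. \<exists>v\<in>cspan F'. norm (y - v) \<le> c' * (1 / R) ^ L"
      using 2[of L] by blast
    have "c * (1 / R) ^ L \<le> max c c' * (1 / R) ^ L" "c' * (1 / R) ^ L \<le> max c c' * (1 / R) ^ L"
      using \<open>R > 0\<close> by (auto intro!: mult_right_mono)
    then have "\<exists>v\<in>cspan F. norm (y - v) \<le> max c c' * (1 / R) ^ L" if "y \<in> Y" for y
      using F(3) that by (meson order_trans)
    moreover have "\<exists>v\<in>cspan F'. norm (y - v) \<le> max c c' * (1 / R) ^ L" if "y \<in> Z" for y
      using F'(3) that \<open>c' * (1 / R) ^ L \<le> max c c' * (1 / R) ^ L\<close> by (meson order_trans)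
    moreover have "cspan F \<subseteq> cspan (F \<union> F')" "cspan F' \<subseteq> cspan (F \<union> F')"
      by (auto intro!: complex_vector.span_mono)
    ultimately have "\<forall>y\<in>Y \<union> Z. \<exists>v\<in>cspan (F \<union> F'). norm (y - v) \<le> max c c' * (1 / R) ^ L"
      by blast
    moreover have "real (card (F \<union> F')) \<le> (\<kappa> + \<kappa>') * \<beta> ^ L"
      using F(2) F'(2) card_Un_le[of F F'] unfolding distrib_right by linarith
    ultimately show "\<exists>F. finite F \<and> real (card F) \<le> (\<kappa> + \<kappa>') * \<beta> ^ L \<and>
        (\<forall>y\<in>Y \<union> Z. \<exists>v\<in>cspan F. norm (y - v) \<le> max c c' * (1 / R) ^ L)"
      using F(1) F'(1) by (intro exI[of _ "F \<union> F'"]) blast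
  qed
qed

lemma geometric_approximation_subset:
  assumes "geometric_approximation R \<beta> Y" "Z \<subseteq> Y"
  shows "geometric_approximation R \<beta> Z"
  using assms unfolding geometric_approximation_def by (meson subsetD)

lemma geometric_approximation_empty: "geometric_approximation R \<beta> {}"
  unfolding geometric_approximation_def
  by (intro exI[of _ 0] allI exI[of _ "{}"]) auto

lemma geometric_approximation_UN:
  assumes "finite I" "\<And>i. i \<in> I \<Longrightarrow> geometric_approximation R \<beta> (Y i)" "R > 0"
  shows "geometric_approximation R \<beta> (\<Union>i\<in>I. Y i)"
  using assms
  by (induction I) (auto intro!: geometric_approximation_Un geometric_approximation_empty)

text \<open>A large \<open>n\<close> lies between two consecutive values of
  \<open>\<kappa> * \<beta> ^ L\<close>, and passing to the lower one costs only a constant factor.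
  For \<open>n < \<kappa>\<close> the zero space suffices, since \<open>Y\<close> is
  bounded.\<close>

lemma width_decay_if_geometric_approximation:
  fixes Y :: "'b :: complex_banach set"
  assumes Y: "geometric_approximation (\<beta> powr t) \<beta> Y" and "\<beta> > 1" "t > 0"
    and C: "\<And>y. y \<in> Y \<Longrightarrow> norm y \<le> C"
  shows "(SUP n\<in>{1::nat..}. ennreal (real n powr t) * kolmogorov_width n Y) < \<infinity>"
proof -
  obtain \<kappa>' c' where *: "\<And>L. \<exists>F. finite F \<and> real (card F) \<le> \<kappa>' * \<beta> ^ L \<and>
        (\<forall>y\<in>Y. \<exists>v\<in>cspan F. norm (y - v) \<le> c' * (1 / \<beta> powr t) ^ L)"
    using Y unfolding geometric_approximation_def by blast
  \<comment> \<open>The given constants carry no sign. Enlarging them makes \<open>\<kappa>\<close>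
    at least 1 and \<open>c\<close> nonnegative; the two entries of \<open>M\<close> treat
    \<open>n < \<kappa>\<close> and \<open>n \<ge> \<kappa>\<close>.\<close>
  define \<kappa> where "\<kappa> = max \<kappa>' 1"
  define c where "c = max c' 0"
  define M where "M = max (C * \<kappa> powr t) (c * (\<kappa> * \<beta>) powr t)"
  have "ennreal (real n powr t) * kolmogorov_width n Y \<le> ennreal M" if "n \<ge> 1" for n
  proof (cases "Y = {}")
    case True
    have "kolmogorov_width n Y \<le> ennreal 0"
      by (rule kolmogorov_width_le[of "{}"]) (use True in auto)
    then show ?thesis by simp
  next
    case False
    then have "C \<ge> 0" using C norm_ge_zero order_trans by blast
    show ?thesis
    proof (cases "real n < \<kappa>")
      case True
      have "kolmogorov_width n Y \<le> ennreal C"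
        by (rule kolmogorov_width_le[of "{}"]) (use C in auto)
      then have "ennreal (real n powr t) * kolmogorov_width n Y \<le> ennreal (real n powr t) * ennreal C"
        by (rule mult_left_mono) simp
      also have "\<dots> = ennreal (C * real n powr t)"
        using \<open>C \<ge> 0\<close> by (simp add: ennreal_mult mult.commute)
      also have "\<dots> \<le> ennreal M"
      proof (rule ennreal_leI)
        have "C * real n powr t \<le> C * \<kappa> powr t"
          using \<open>C \<ge> 0\<close> True \<open>t > 0\<close> by (intro mult_left_mono powr_mono2) auto
        then show "C * real n powr t \<le> M" by (simp add: M_def)
      qed
      finally show ?thesis .
    next
      case False
      have \<kappa>1: "\<kappa> \<ge> 1" by (simp add: \<kappa>_def)
      \<comment> \<open>The index \<open>L\<close> sought is the place where \<open>P\<close> turns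
        from false to true:
        \<open>\<kappa> * \<beta> ^ L \<le> n < \<kappa> * \<beta> ^ Suc L\<close>.\<close>
      define P where "P L \<longleftrightarrow> real n < \<kappa> * \<beta> ^ L" for L
      obtain L0 where "real n / \<kappa> < \<beta> ^ L0" using real_arch_pow[OF \<open>\<beta> > 1\<close>] by blast
      then have "P L0" using \<kappa>1 by (simp add: P_def field_simps)
      moreover have "\<not> P 0" using False by (simp add: P_def)
      ultimately obtain L where L: "\<not> P L" "P (Suc L)"
        using ex_least_nat_less[of P L0] by (metis less_eq_nat.simps(1) order_refl lessI)
      obtain F where F: "finite F" "real (card F) \<le> \<kappa>' * \<beta> ^ L"
        "\<forall>y\<in>Y. \<exists>v\<in>cspan F. norm (y - v) \<le> c' * (1 / \<beta> powr t) ^ L"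
        using *[of L] by blast
      have "\<kappa>' * \<beta> ^ L \<le> \<kappa> * \<beta> ^ L"
        using \<open>\<beta> > 1\<close> by (intro mult_right_mono) (auto simp: \<kappa>_def)
      with F(2) L(1) have "card F \<le> n" by (simp add: P_def)
      let ?e = "c * (1 / \<beta> powr t) ^ L"
      have "c' * (1 / \<beta> powr t) ^ L \<le> ?e" by (intro mult_right_mono) (auto simp: c_def)
      then have "kolmogorov_width n Y \<le> ennreal ?e"
        using F(1,3) \<open>card F \<le> n\<close> by (intro kolmogorov_width_le[of F]) (meson order_trans)+
      then have "ennreal (real n powr t) * kolmogorov_width n Y \<le> ennreal (real n powr t) * ennreal ?e"
        by (rule mult_left_mono) simp
      also have "\<dots> = ennreal (real n powr t * ?e)"
        by (simp add: ennreal_mult c_def)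
      also have "\<dots> \<le> ennreal M"
      proof (rule ennreal_leI)
        have \<beta>L: "(\<beta> powr t) ^ L = (\<beta> ^ L) powr t"
          using \<open>\<beta> > 1\<close> by (simp add: powr_power powr_realpow[symmetric] powr_powr mult.commute)
        have "real n powr t \<le> (\<kappa> * \<beta> * \<beta> ^ L) powr t"
          using L(2) \<open>t > 0\<close> by (intro powr_mono2) (auto simp: P_def mult_ac)
        also have "\<dots> = (\<kappa> * \<beta>) powr t * (\<beta> powr t) ^ L"
          using \<kappa>1 \<open>\<beta> > 1\<close> by (simp add: powr_mult \<beta>L)
        finally have "real n powr t * ?e \<le> (\<kappa> * \<beta>) powr t * (\<beta> powr t) ^ L * ?e"
          by (intro mult_right_mono) (auto simp: c_def)
        also have "\<dots> = c * (\<kappa> * \<beta>) powr t"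
          using \<open>\<beta> > 1\<close> by (simp add: power_divide)
        finally show "real n powr t * ?e \<le> M" by (simp add: M_def)
      qed
      finally show ?thesis .
    qed
  qed
  then have "(SUP n\<in>{1::nat..}. ennreal (real n powr t) * kolmogorov_width n Y) \<le> ennreal M"
    by (intro SUP_least) auto
  then show ?thesis by (simp add: le_less_trans)
qed

section \<open>Local approximation of the image\<close>

text \<open>The constant term \<open>u a\<close> becomes the 0-linear map \<open>A 0\<close>, for
  which multilinearity is vacuous, so that the Taylor series is one sum over all
  \<open>m\<close>.\<close>

lemma holomorphic_map_onE:
  fixes u :: "'a :: complex_banach \<Rightarrow> 'b :: complex_banach"
  assumes "holomorphic_map_on u S" "a \<in> S"
  obtains r A where "r > 0" "ball a r \<subseteq> S" "\<And>m. cmultilinear m (A m)"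
    "uniform_limit (ball a r) (\<lambda>N x. \<Sum>m\<le>N. A m (replicate m (x - a))) u sequentially"
proof -
  obtain r P where r: "r > 0" "ball a r \<subseteq> S"
    and P: "\<And>m. m \<ge> 1 \<Longrightarrow> continuous_homogeneous_polynomial m (P m)"
    and lim: "uniform_limit (ball a r) (\<lambda>N x. u a + (\<Sum>m = 1..N. P m (x - a))) u sequentially"
    using assms unfolding holomorphic_map_on_def by metis
  have "\<exists>A. cmultilinear m A \<and> (m \<ge> 1 \<longrightarrow> P m = (\<lambda>x. A (replicate m x)))
      \<and> (m = 0 \<longrightarrow> A = (\<lambda>_. u a))" for m
  proof (cases "m = 0")
    case False
    then show ?thesis using P[of m] by (auto simp: continuous_homogeneous_polynomial_def)
  qed (auto simp: cmultilinear_def)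
  then obtain A where A: "\<And>m. cmultilinear m (A m)"
    "\<And>m. m \<ge> 1 \<Longrightarrow> P m = (\<lambda>x. A m (replicate m x))" "A 0 = (\<lambda>_. u a)"
    by metis
  have "u a + (\<Sum>m = 1..N. P m (x - a)) = (\<Sum>m\<le>N. A m (replicate m (x - a)))" for N x
    by (simp add: atMost_atLeast0 sum.atLeast_Suc_atMost A(2,3))
  with lim have "uniform_limit (ball a r) (\<lambda>N x. \<Sum>m\<le>N. A m (replicate m (x - a))) u sequentially"
    by simp
  with r A(1) show thesis using that by blast
qed

lemma power_tendsto_0_mult:
  fixes x y :: real
  assumes "0 \<le> x" "x < 1" "0 < e"
  shows "\<forall>\<^sub>F q in sequentially. y * x ^ q < e"
proof -
  have "(\<lambda>q. y * x ^ q) \<longlonglongrightarrow> y * 0"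
    by (intro tendsto_intros LIMSEQ_realpow_zero assms)
  then show ?thesis using assms(3) by (intro order_tendstoD(2)) auto
qed

lemma local_geometric_approximation:
  fixes u :: "'a :: complex_banach \<Rightarrow> 'b :: complex_banach"
  assumes u: "holomorphic_map_on u S" "a \<in> S" and C: "\<And>y. y \<in> S \<Longrightarrow> norm (u y) \<le> C"
    and E: "\<And>j. finite (E j)" "\<And>j. card (E j) \<le> 2 ^ j"
    and approx: "\<And>j x. x \<in> K \<Longrightarrow> \<exists>v\<in>cspan (E j). norm (x - v) < c * (1 / \<sigma>) ^ j"
    and "c > 0" "1 < R" "R < \<sigma>" "2 < \<beta>"
  shows "\<exists>\<rho>>0. geometric_approximation R \<beta> (u ` (K \<inter> ball a \<rho>))"
proof -
  obtain r A where r: "r > 0" "ball a r \<subseteq> S" and A: "\<And>m. cmultilinear m (A m)"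
    and lim: "uniform_limit (ball a r) (\<lambda>N x. \<Sum>m\<le>N. A m (replicate m (x - a))) u sequentially"
    by (rule holomorphic_map_onE[OF u]) blast
  define \<theta> where "\<theta> = R / \<sigma>"
  define \<eta> where "\<eta> = 2 / \<beta>"
  have \<theta>: "0 \<le> \<theta>" "\<theta> < 1" and \<eta>: "0 \<le> \<eta>" "\<eta> < 1"
    using \<open>1 < R\<close> \<open>R < \<sigma>\<close> \<open>2 < \<beta>\<close> by (auto simp: \<theta>_def \<eta>_def)
  \<comment> \<open>The four demands on \<open>q\<close>: the curve stays in
    \<open>ball a r\<close>, the letters satisfy the hypothesis of
    \<open>weighted_word_card\<close>, \<open>ball a \<rho>\<close> lies in \<open>ball a r\<close>,
    and level 0 is below \<open>q\<close>.\<close>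
  have "\<forall>\<^sub>F q in sequentially. c * (1 + \<sigma>) / (1 - \<theta>) * \<theta> ^ q < r \<and> 2 / (1 - \<eta>) * \<eta> ^ q < 1
      \<and> c * (1 / \<sigma>) ^ q < r \<and> q \<ge> 1"
    using \<theta> \<eta> r by (intro eventually_conj power_tendsto_0_mult eventually_ge_at_top)
      (use \<open>1 < R\<close> \<open>R < \<sigma>\<close> in auto)
  then obtain q where q1: "c * (1 + \<sigma>) / (1 - \<theta>) * \<theta> ^ q < r"
    and q2: "2 / (1 - \<eta>) * \<eta> ^ q < 1"
    and q3: "c * (1 / \<sigma>) ^ q < r" and "q \<ge> 1"
    by (metis (mono_tags, lifting) eventually_sequentially order_refl)
  \<comment> \<open>With this radius, \<open>a\<close> itself approximates the points near it as
    well as required at all levels up to \<open>q\<close>. It therefore replaces the spaces below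
    \<open>q\<close>, and a letter set is empty below \<open>q\<close> and generates differences of
    consecutive approximants from \<open>q\<close> on.\<close>
  define \<rho> where "\<rho> = c * (1 / \<sigma>) ^ q"
  define E' where "E' j = (if j < q then {a} else E j)" for j
  define B where "B j = (if j < q then {} else E' j \<union> E' (j - 1))" for j
  have E': "finite (E' j)" "card (E' j) \<le> 2 ^ j" for j
    using E by (auto simp: E'_def)
  have fB: "finite (B j)" for j using E' by (auto simp: B_def)
  have cB: "real (card (B j)) \<le> 2 * 2 ^ j" for j
  proof -
    have "card (B j) \<le> card (E' j) + card (E' (j - 1))"
      by (auto simp: B_def card_Un_le)
    also have "\<dots> \<le> 2 ^ j + 2 ^ (j - 1)" by (intro add_mono E')
    also have "(2::nat) ^ (j - 1) \<le> 2 ^ j" by (intro power_increasing) auto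
    finally have "card (B j) \<le> 2 * 2 ^ j" by simp
    then show ?thesis by (metis (mono_tags) of_nat_le_iff of_nat_mult of_nat_numeral of_nat_power)
  qed
  have "(\<Sum>j = 1..n. real (card (B j)) * (1 / \<beta>) ^ j) \<le> 1" for n
  proof -
    have "(\<Sum>j = 1..n. real (card (B j)) * (1 / \<beta>) ^ j)
        = (\<Sum>j = q..<Suc n. real (card (B j)) * (1 / \<beta>) ^ j)"
      using \<open>q \<ge> 1\<close> by (intro sum.mono_neutral_right) (auto simp: B_def)
    also have "\<dots> \<le> (\<Sum>j = q..<Suc n. 2 * \<eta> ^ j)"
    proof (rule sum_mono)
      fix j
      have "real (card (B j)) * (1 / \<beta>) ^ j \<le> 2 * 2 ^ j * (1 / \<beta>) ^ j"
        using \<open>2 < \<beta>\<close> by (intro mult_right_mono cB) auto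
      then show "real (card (B j)) * (1 / \<beta>) ^ j \<le> 2 * \<eta> ^ j"
        by (simp add: \<eta>_def power_divide)
    qed
    also have "\<dots> \<le> 2 * (\<eta> ^ q / (1 - \<eta>))"
      unfolding sum_distrib_left[symmetric] using \<eta>
      by (intro mult_left_mono geometric_segment_le) auto
    finally show ?thesis using q2 by simp
  qed
  then have W: "finite {bs. weighted_word B l bs}" "real (card {bs. weighted_word B l bs}) \<le> \<beta> ^ l" for l
    using weighted_word_card[of B \<beta> l] fB \<open>q \<ge> 1\<close> \<open>2 < \<beta>\<close> by (auto simp: B_def)
  define F where "F L = (\<lambda>bs. A (length bs) bs) ` {bs. \<exists>l\<le>L. weighted_word B l bs}" for L
  have F: "finite (F L)" "real (card (F L)) \<le> \<beta> / (\<beta> - 1) * \<beta> ^ L" for L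
  proof -
    have eq: "{bs. \<exists>l\<le>L. weighted_word B l bs} = (\<Union>l\<in>{..L}. {bs. weighted_word B l bs})" by auto
    show "finite (F L)" using W unfolding F_def eq by auto
    have "card (F L) \<le> card {bs. \<exists>l\<le>L. weighted_word B l bs}"
      unfolding F_def by (rule card_image_le) (use W in \<open>auto simp: eq\<close>)
    also have "\<dots> \<le> (\<Sum>l\<le>L. card {bs. weighted_word B l bs})"
      unfolding eq by (rule card_UN_le) simp
    finally have "real (card (F L)) \<le> (\<Sum>l\<le>L. real (card {bs. weighted_word B l bs}))"
      by (simp flip: of_nat_sum)
    also have "\<dots> \<le> (\<Sum>l\<le>L. \<beta> ^ l)" by (intro sum_mono W)
    also have "\<dots> = (\<beta> ^ Suc L - 1) / (\<beta> - 1)"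
      using geometric_sum[of \<beta> "Suc L"] \<open>2 < \<beta>\<close> by (simp add: lessThan_Suc_atMost)
    also have "\<dots> \<le> \<beta> ^ Suc L / (\<beta> - 1)"
      using \<open>2 < \<beta>\<close> by (intro divide_right_mono) auto
    finally show "real (card (F L)) \<le> \<beta> / (\<beta> - 1) * \<beta> ^ L" by simp
  qed
  have "norm (u a) \<ge> 0" by simp
  then have "C \<ge> 0" using C[OF u(2)] by linarith
  \<comment> \<open>The first entry serves the finitely many levels \<open>L < q\<close>, where 0 is
    the approximant and \<open>R ^ q\<close> absorbs the factor \<open>(1 / R) ^ L\<close>. The
    second comes from \<open>taylor_truncation\<close>.\<close>
  define c' where "c' = max (C * R ^ q) ((C + 1) / (R - 1) + 1)"
  have "\<exists>v\<in>cspan (F L). norm (u x - v) \<le> c' * (1 / R) ^ L" if x: "x \<in> K" "x \<in> ball a \<rho>" for L x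
  proof (cases "L < q")
    case True
    have "x \<in> ball a r" using x(2) q3 by (simp add: \<rho>_def)
    then have "norm (u x - 0) \<le> C" using C r by auto
    also have "\<dots> \<le> C * R ^ q * (1 / R) ^ L"
    proof -
      have "R ^ q * (1 / R) ^ L = R ^ (q - L)"
        using True \<open>1 < R\<close> by (simp add: power_diff power_divide)
      then have "1 \<le> R ^ q * (1 / R) ^ L" using \<open>1 < R\<close> by simp
      then show ?thesis using mult_left_mono[OF _ \<open>C \<ge> 0\<close>] by (simp add: mult.assoc) fastforce
    qed
    also have "\<dots> \<le> c' * (1 / R) ^ L"
      using \<open>1 < R\<close> by (intro mult_right_mono) (auto simp: c'_def)
    finally show ?thesis using complex_vector.span_zero by blast
  next
    case False
    obtain w0 where w0: "\<And>j. w0 j \<in> cspan (E j)" "\<And>j. norm (x - w0 j) < c * (1 / \<sigma>) ^ j"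
      using approx[OF x(1)] by metis
    \<comment> \<open>The path starts at \<open>a\<close> and reaches \<open>x\<close> itself at
      level \<open>L + 1\<close>, so a finite telescoping sum represents \<open>x - a\<close>
      exactly. Truncated subtraction makes \<open>\<delta> 0\<close> vanish.\<close>
    define w where "w j = (if L < j then x else if j < q then a else w0 j)" for j
    define \<delta> where "\<delta> j = w j - w (j - 1)" for j
    have w: "w j \<in> cspan (E' j)" if "j \<le> L" for j
      using that w0 by (auto simp: w_def E'_def intro: complex_vector.span_base)
    have \<delta>B: "\<delta> j \<in> cspan (B j)" if "j \<le> L" for j
    proof (cases "j < q")
      case True
      then show ?thesis using that by (auto simp: \<delta>_def w_def complex_vector.span_zero)
    next
      case False
      then show ?thesis
        using w[of j] w[of "j - 1"] that complex_vector.span_mono[of "E' j" "B j"]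
          complex_vector.span_mono[of "E' (j - 1)" "B j"]
        by (auto simp: \<delta>_def B_def intro!: complex_vector.span_diff)
    qed
    \<comment> \<open>The range begins at \<open>q - 1\<close> because the first nontrivial
      increment, \<open>\<delta> q\<close>, starts from \<open>w (q - 1) = a\<close>; there the
      bound comes from \<open>x \<in> ball a \<rho>\<close>.\<close>
    have xw: "norm (x - w j) \<le> c * (1 / \<sigma>) ^ j" if "j \<ge> q - 1" for j
    proof (cases "L < j \<or> j \<ge> q")
      case True
      then show ?thesis using w0(2)[of j] \<open>c > 0\<close> \<open>1 < R\<close> \<open>R < \<sigma>\<close> by (auto simp: w_def)
    next
      case False
      then have "norm (x - w j) \<le> \<rho>" using x(2) by (auto simp: w_def dist_norm norm_minus_commute)
      also have "\<dots> \<le> c * (1 / \<sigma>) ^ j"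
        unfolding \<rho>_def using False \<open>c > 0\<close> \<open>1 < R\<close> \<open>R < \<sigma>\<close>
        by (intro mult_left_mono power_decreasing) auto
      finally show ?thesis .
    qed
    have n\<delta>: "R ^ j * norm (\<delta> j) \<le> c * (1 + \<sigma>) * \<theta> ^ j" if "q \<le> j" for j
    proof -
      obtain i where j: "j = Suc i" using \<open>q \<le> j\<close> \<open>q \<ge> 1\<close> by (cases j) auto
      have "norm (\<delta> j) \<le> norm (x - w (j - 1)) + norm (x - w j)"
        using norm_triangle_ineq4[of "x - w (j - 1)" "x - w j"] by (simp add: \<delta>_def)
      also have "\<dots> \<le> c * (1 / \<sigma>) ^ (j - 1) + c * (1 / \<sigma>) ^ j"
        using that by (intro add_mono xw) auto
      also have "\<dots> = c * (1 + \<sigma>) * (1 / \<sigma>) ^ j"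
        using \<open>1 < R\<close> \<open>R < \<sigma>\<close> by (simp add: j field_simps)
      finally have "R ^ j * norm (\<delta> j) \<le> R ^ j * (c * (1 + \<sigma>) * (1 / \<sigma>) ^ j)"
        using \<open>1 < R\<close> by (intro mult_left_mono) auto
      then show ?thesis by (simp add: \<theta>_def power_divide mult_ac)
    qed
    have \<delta>0: "\<delta> j = 0" if "j < q" for j
      using that False by (auto simp: \<delta>_def w_def)
    have "(\<Sum>j\<le>Suc L. R ^ j * norm (\<delta> j)) = (\<Sum>j = q..<Suc (Suc L). R ^ j * norm (\<delta> j))"
      by (rule sum.mono_neutral_right) (auto simp: \<delta>0)
    also have "\<dots> \<le> (\<Sum>j = q..<Suc (Suc L). c * (1 + \<sigma>) * \<theta> ^ j)"
      by (rule sum_mono) (use n\<delta> in auto)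
    also have "\<dots> \<le> c * (1 + \<sigma>) * (\<theta> ^ q / (1 - \<theta>))"
      unfolding sum_distrib_left[symmetric] using \<theta> \<open>c > 0\<close> \<open>1 < R\<close> \<open>R < \<sigma>\<close>
      by (intro mult_left_mono geometric_segment_le) auto
    also have "\<dots> < r" using q1 by simp
    finally have sum_r: "(\<Sum>j\<le>Suc L. R ^ j * norm (\<delta> j)) < r" .
    have "(\<Sum>j\<le>n. \<delta> j) = w n - w 0" for n
      by (induction n) (auto simp: \<delta>_def)
    from this[of "Suc L"] have "x - a = (\<Sum>j\<le>Suc L. \<delta> j)"
      using \<open>q \<ge> 1\<close> False by (simp add: w_def del: sum.atMost_Suc)
    from taylor_truncation[OF \<open>1 < R\<close> A lim _ \<delta>B this sum_r, of C]
    obtain v where v: "v \<in> cspan (F L)" "norm (u x - v) \<le> ((C + 1) / (R - 1) + 1) * (1 / R) ^ L"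
      using C r unfolding F_def by blast
    moreover have "((C + 1) / (R - 1) + 1) * (1 / R) ^ L \<le> c' * (1 / R) ^ L"
      using \<open>1 < R\<close> by (intro mult_right_mono) (auto simp: c'_def)
    ultimately show ?thesis by (meson order_trans)
  qed
  then have "geometric_approximation R \<beta> (u ` (K \<inter> ball a \<rho>))"
    unfolding geometric_approximation_def using F by blast
  moreover have "\<rho> > 0"
    using \<open>c > 0\<close> \<open>1 < R\<close> \<open>R < \<sigma>\<close> by (simp add: \<rho>_def)
  ultimately show ?thesis by blast
qed

section \<open>From local to global by compactness\<close>

theorem theorem1p1:
  fixes u :: "'a :: complex_banach \<Rightarrow> 'b :: complex_banach"
    and \<O> \<K> :: "'a set" and C s t :: real
  assumes "open \<O>"
    and "compact \<K>" and "\<K> \<subseteq> \<O>"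
    and "holomorphic_map_on u \<O>"
    and "\<forall>a\<in>\<O>. norm (u a) \<le> C"
    and "s > 0"
    and "(SUP n\<in>{1::nat..}. ennreal (real n powr s) * kolmogorov_width n \<K>) < \<infinity>"
    and "0 < t" and "t < s"
  shows "(SUP n\<in>{1::nat..}. ennreal (real n powr t) * kolmogorov_width n (u ` \<K>)) < \<infinity>"
proof -
  obtain c0 where c0: "c0 > 0"
    "(SUP n\<in>{1::nat..}. ennreal (real n powr s) * kolmogorov_width n \<K>) < ennreal c0"
  proof (cases "SUP n\<in>{1::nat..}. ennreal (real n powr s) * kolmogorov_width n \<K>")
    case (real b)
    then show thesis by (intro that[of "b + 1"]) (auto simp: ennreal_less_iff)
  next
    case top
    with assms(7) show thesis by (metis infinity_ennreal_def less_irrefl)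
  qed
  \<comment> \<open>The intermediate exponent is the midpoint of \<open>s\<close> and
    \<open>t\<close>. Then \<open>R < \<sigma>\<close> makes the weighted increments summable, and
    \<open>\<beta> > 2\<close> makes the generating function of the letters converge.\<close>
  define \<sigma> where "\<sigma> = 2 powr s"
  define R where "R = 2 powr ((s + t) / 2)"
  define \<beta> where "\<beta> = 2 powr ((s + t) / (2 * t))"
  have R: "1 < R" "R < \<sigma>" and \<beta>: "2 < \<beta>" and R_eq: "R = \<beta> powr t"
  proof -
    show "1 < R" "R < \<sigma>" using assms(8,9) by (auto simp: R_def \<sigma>_def)
    have "(2::real) powr 1 < \<beta>" unfolding \<beta>_def using assms(8,9) by (intro powr_less_mono) auto
    then show "2 < \<beta>" by simp
    show "R = \<beta> powr t" using assms(8) by (simp add: R_def \<beta>_def powr_powr)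
  qed
  \<comment> \<open>The hypothesis is used at \<open>n = 2 ^ j\<close>, where
    \<open>n powr s\<close> is \<open>\<sigma> ^ j\<close>. As \<open>c0\<close> strictly exceeds
    the supremum, the width is strictly below \<open>c0 * (1 / \<sigma>) ^ j\<close>, as
    \<open>kolmogorov_width_lessE\<close> demands.\<close>
  have "\<exists>E. finite E \<and> card E \<le> 2 ^ j \<and> (\<forall>x\<in>\<K>. \<exists>v\<in>cspan E. norm (x - v) < c0 * (1 / \<sigma>) ^ j)" for j
  proof -
    have \<sigma>j: "real (2 ^ j) powr s = \<sigma> ^ j" 
      by (simp add: \<sigma>_def powr_power powr_realpow[symmetric] powr_powr mult.commute)
    have "ennreal (\<sigma> ^ j) * kolmogorov_width (2 ^ j) \<K> < ennreal c0"
      unfolding \<sigma>j[symmetric] by (rule le_less_trans[OF SUP_upper c0(2)]) simp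
    then have "ennreal ((1 / \<sigma>) ^ j) * (ennreal (\<sigma> ^ j) * kolmogorov_width (2 ^ j) \<K>)
        < ennreal ((1 / \<sigma>) ^ j) * ennreal c0"
      by (intro ennreal_mult_strict_left_mono) (auto simp: \<sigma>_def)
    also have "ennreal ((1 / \<sigma>) ^ j) * (ennreal (\<sigma> ^ j) * kolmogorov_width (2 ^ j) \<K>)
        = kolmogorov_width (2 ^ j) \<K>"
      by (simp add: mult.assoc[symmetric] ennreal_mult[symmetric] \<sigma>_def power_divide)
    also have "ennreal ((1 / \<sigma>) ^ j) * ennreal c0 = ennreal (c0 * (1 / \<sigma>) ^ j)"
      using c0(1) by (simp add: ennreal_mult mult.commute \<sigma>_def)
    finally show ?thesis by (elim kolmogorov_width_lessE) blast
  qed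
  then obtain E where E: "\<And>j. finite (E j)" "\<And>j. card (E j) \<le> 2 ^ j"
    "\<And>j x. x \<in> \<K> \<Longrightarrow> \<exists>v\<in>cspan (E j). norm (x - v) < c0 * (1 / \<sigma>) ^ j"
    by metis
  have "\<exists>\<rho>>0. geometric_approximation R \<beta> (u ` (\<K> \<inter> ball a \<rho>))" if "a \<in> \<K>" for a
    by (rule local_geometric_approximation[OF assms(4) _ _ E c0(1) R \<beta>]) (use assms that in auto)
  then obtain \<rho> where \<rho>: "\<And>a. a \<in> \<K> \<Longrightarrow> \<rho> a > 0"
    "\<And>a. a \<in> \<K> \<Longrightarrow> geometric_approximation R \<beta> (u ` (\<K> \<inter> ball a (\<rho> a)))"
    by metis
  have "\<K> \<subseteq> (\<Union>a\<in>\<K>. ball a (\<rho> a))" using \<rho>(1) by force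
  then obtain I where I: "I \<subseteq> \<K>" "finite I" "\<K> \<subseteq> (\<Union>a\<in>I. ball a (\<rho> a))"
    using compactE_image[OF assms(2), of \<K> "\<lambda>a. ball a (\<rho> a)"] by (metis open_ball)
  have "geometric_approximation R \<beta> (\<Union>a\<in>I. u ` (\<K> \<inter> ball a (\<rho> a)))"
    using I \<rho> R by (intro geometric_approximation_UN) auto
  then have "geometric_approximation R \<beta> (u ` \<K>)"
    by (rule geometric_approximation_subset) (use I(3) in blast)
  then show ?thesis
    unfolding R_eq
    by (rule width_decay_if_geometric_approximation[where C = C]) (use \<beta> assms in auto)
qed

end
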